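(* For any odd integer $k \geq 5$, the edges of the bumpy wheel $BW_{k,5}$ cannot be partitioned into $n = \frac{5k+1}{2}$ plane subgraphs.
   Context: A geometric graph is a graph drawn in the plane whose vertices are points in general position and whose edges are straight-line segments; it is plane if no two edges share a point of their relative interiors. A partition of a graph into subgraphs is a set of edge-disjoint subgraphs whose union is the graph. For odd integers $k,\ell\ge 3$, the bumpy wheel $BW_{k,\ell}$ is the complete geometric graph on the following set of $k\ell+1$ points: take a regular $k$-gon with center $v_0$ and replace each of its $k$ vertices by a group of $\ell$ points that are $\varepsilon$-close for a sufficiently small $\varepsilon>0$, such that all $k\ell$ points other than $v_0$ lie on the convex hull (in convex position), $v_0$ is the only interior point, and the convex hull of any $\frac{k+1}{2}$ consecutive groups does not contain $v_0$. *)

theory Defs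
  imports "HOL-Analysis.Analysis"
begin

definition general_position :: "complex set \<Rightarrow> bool" where
  "general_position P \<longleftrightarrow>
     (\<forall>a\<in>P. \<forall>b\<in>P. \<forall>c\<in>P. a \<noteq> b \<and> a \<noteq> c \<and> b \<noteq> c \<longrightarrow> \<not> collinear {a, b, c})"

text \<open>A geometric graph is a pair of a vertex set in the plane and a set of two-element
  edges; the edge \<open>{x, y}\<close> is drawn as the segment \<open>convex hull {x, y}\<close>.\<close>

type_synonym geom_graph = "complex set \<times> complex set set"

abbreviation verts :: "geom_graph \<Rightarrow> complex set" where
  "verts G \<equiv> fst G"

abbreviation edges :: "geom_graph \<Rightarrow> complex set set" where
  "edges G \<equiv> snd G"

definition geometric_graph :: "geom_graph \<Rightarrow> bool" where
  "geometric_graph G \<longleftrightarrow>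
     finite (verts G) \<and> general_position (verts G) \<and>
     (\<forall>e\<in>edges G. e \<subseteq> verts G \<and> card e = 2)"

definition plane_graph :: "geom_graph \<Rightarrow> bool" where
  "plane_graph G \<longleftrightarrow> geometric_graph G \<and>
     (\<forall>e\<in>edges G. \<forall>f\<in>edges G. e \<noteq> f \<longrightarrow>
        rel_interior (convex hull e) \<inter> rel_interior (convex hull f) = {})"

definition subgraph :: "geom_graph \<Rightarrow> geom_graph \<Rightarrow> bool" where
  "subgraph H G \<longleftrightarrow> geometric_graph H \<and> verts H \<subseteq> verts G \<and> edges H \<subseteq> edges G"

text \<open>Subgraphs without edges are not excluded from a partition.\<close>

definition graph_partition :: "geom_graph \<Rightarrow> geom_graph set \<Rightarrow> bool" where
  "graph_partition G \<H> \<longleftrightarrow>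
     (\<forall>H\<in>\<H>. subgraph H G) \<and>
     pairwise (\<lambda>H H'. edges H \<inter> edges H' = {}) \<H> \<and>
     (\<Union>H\<in>\<H>. verts H) = verts G \<and>
     (\<Union>H\<in>\<H>. edges H) = edges G"

definition complete_geometric_graph :: "complex set \<Rightarrow> geom_graph" where
  "complete_geometric_graph P = (P, {e. e \<subseteq> P \<and> card e = 2})"

definition regular_polygon_vertex :: "nat \<Rightarrow> complex \<Rightarrow> real \<Rightarrow> real \<Rightarrow> nat \<Rightarrow> complex" where
  "regular_polygon_vertex k c r t j = c + of_real r * cis (t + 2 * pi * real j / real k)"

text \<open>The vertices of the regular \<open>k\<close>-gon with centre \<open>v0\<close>, circumradius \<open>r\<close> and rotation
  angle \<open>t\<close> are replaced by the groups \<open>S 0, \<dots>, S (k - 1)\<close>, in this cyclic order.  The groups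
  are not determined by the polygon and \<open>\<epsilon>\<close>, so this is a predicate on graphs; that \<open>\<epsilon>\<close> be
  sufficiently small is left to the quantification over \<open>\<epsilon>\<close> where the predicate is used.\<close>

definition bumpy_wheel ::
  "nat \<Rightarrow> nat \<Rightarrow> complex \<Rightarrow> real \<Rightarrow> real \<Rightarrow> real \<Rightarrow> geom_graph \<Rightarrow> bool" where
  "bumpy_wheel k l v0 r t \<epsilon> W \<longleftrightarrow>
     odd k \<and> 3 \<le> k \<and> odd l \<and> 3 \<le> l \<and> 0 < r \<and> 0 < \<epsilon> \<and>
     (\<exists>S P. P = insert v0 (\<Union>j<k. S j) \<and>
        (\<forall>j<k. finite (S j) \<and> card (S j) = l) \<and>
        disjoint_family_on S {..<k} \<and>
        (\<forall>j<k. \<forall>x\<in>S j. dist x (regular_polygon_vertex k v0 r t j) < \<epsilon>) \<and>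
        general_position P \<and>
        (\<forall>j<k. \<forall>x\<in>S j. x extreme_point_of (convex hull P)) \<and>
        v0 \<in> interior (convex hull P) \<and>
        (\<forall>j<k. v0 \<notin> convex hull (\<Union>i<(k + 1) div 2. S ((j + i) mod k))) \<and>
        W = complete_geometric_graph P)"

end

theory Submission
  imports Defs
begin

text \<open>The hull points, sorted by angle about the centre, are indexed by the integers modulo
  \<open>m = 2 L + 1 = 5 k\<close>, and a partition into plane subgraphs is a colouring of the edges with \<open>L + 1\<close>
  colours in which crossing edges differ.  Two longest diagonals \<open>(x, x + L)\<close> cross unless they share
  an endpoint, so each colour occurs on at most two of them; by counting, all colours but one occur on
  a wedge \<open>(p, p + L), (p, p + L + 1)\<close>, and the apexes \<open>p\<close> form an interval of \<open>L\<close> consecutive points.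
  On each side of a wedge the diagonals \<open>(x, x + L - 2)\<close> cross pairwise, so counting again shows
  that, with a single exception, each side contains exactly one such diagonal of its colour.

  Let \<open>u, u + 1\<close> be apexes in different groups.  A colour with a diagonal \<open>(x, x + L - 2)\<close> on the
  side of the centre cannot contain the spoke to the middle point \<open>u + L + 1\<close> of the opposite
  group, so that spoke has the exceptional colour.  This determines which diagonals
  \<open>(x, x + L - 2)\<close> the wedges at \<open>u\<close> and \<open>u + 1\<close> carry on one of their sides, and the colours of the
  spokes to \<open>u - 1\<close> and \<open>u + 2\<close> and of the four diagonals \<open>(x, x + L - 1)\<close> joining \<open>u, u + 1\<close> to
  the opposite group then contradict each other.\<close>

section \<open>Colourings of the diagonals and spokes\<close>

lemma int_dvd_diff_eq:
  fixes n x y :: int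
  assumes "n dvd x - y" "\<bar>x - y\<bar> < n"
  shows "x = y"
proof (rule ccontr)
  assume "x \<noteq> y"
  then have "\<bar>n\<bar> \<le> \<bar>x - y\<bar>" using assms(1) by (intro dvd_imp_le_int) auto
  then show False using assms(2) by linarith
qed

text \<open>The points are indexed by all integers with period \<open>10 h + 5\<close>, and \<open>i div 5\<close> is the group of
  \<open>i\<close>.  \<open>c i j\<close> is the colour of the diagonal between \<open>i\<close> and \<open>j\<close>, and \<open>r y\<close> that of the edge from
  the centre to \<open>y\<close>.  A diagonal spanning at most \<open>h\<close> group steps separates the centre from the
  points between its endpoints.\<close>

locale wheel_colouring =
  fixes h :: int and C :: "'c set" and c :: "int \<Rightarrow> int \<Rightarrow> 'c" and r :: "int \<Rightarrow> 'c"
  assumes h_ge: "2 \<le> h"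
    and finite_C: "finite C"
    and card_C: "int (card C) = 5 * h + 3"
    and c_in: "\<And>i j. i < j \<Longrightarrow> j < i + (10 * h + 5) \<Longrightarrow> c i j \<in> C"
    and r_in: "\<And>y. r y \<in> C"
    and c_wrap: "\<And>i j. c j (i + (10 * h + 5)) = c i j"
    and r_period: "\<And>y. r (y + (10 * h + 5)) = r y"
    and cross: "\<And>i k j l. i < k \<Longrightarrow> k < j \<Longrightarrow> j < l \<Longrightarrow> l < i + (10 * h + 5) \<Longrightarrow> c i j \<noteq> c k l"
    and hide: "\<And>i y j. i < y \<Longrightarrow> y < j \<Longrightarrow> j div 5 \<le> i div 5 + h \<Longrightarrow> r y \<noteq> c i j"
begin

section \<open>Crossings among the longest and nearly longest diagonals\<close>

abbreviation L :: int where "L \<equiv> 5 * h + 2"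
abbreviation m :: int where "m \<equiv> 10 * h + 5"

text \<open>As \<open>m = 2 * L + 1\<close>, no diagonal is longer than those of \<open>t\<close>.
  Those of \<open>f\<close> have length \<open>5 * h\<close> and so span exactly \<open>h\<close>
  group steps, whatever the residue of \<open>x\<close>.\<close>

definition t :: "int \<Rightarrow> 'c" where "t x = c x (x + L)"
definition e :: "int \<Rightarrow> 'c" where "e x = c x (x + L - 1)"
definition f :: "int \<Rightarrow> 'c" where "f x = c x (x + L - 2)"

lemma c_period: "c (i + m) (j + m) = c i j"
  using c_wrap[of "i + m" j] c_wrap[of j i] by simp

lemma t_period: "t (x + m) = t x" and f_period: "f (x + m) = f x"
  using c_period[of x "x + L"] c_period[of x "x + L - 2"]
  by (simp_all add: t_def f_def algebra_simps)

lemma t_period': "t (x - m) = t x"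
  using t_period[of "x - m"] by simp

lemma t_mod: "t (x mod m) = t x"
proof -
  have *: "t (y + m * int i) = t y" for y i
    by (induction i) (use t_period[of "y + m * int i" for i] in \<open>auto simp: algebra_simps\<close>)
  have "t (y + m * i) = t y" for y i
    using *[of y "nat i"] *[of "y + m * i" "nat (- i)"] by (cases "i \<ge> 0") auto
  from this[of "x mod m" "x div m"] show ?thesis by simp
qed

lemma t_in: "t x \<in> C" and e_in: "e x \<in> C" and f_in: "f x \<in> C"
  using h_ge by (auto simp: t_def e_def f_def intro!: c_in)

lemma t_neq_t: "x < y \<Longrightarrow> y < x + L \<Longrightarrow> t x \<noteq> t y"
  unfolding t_def by (rule cross) auto

lemma f_neq_f: "x < y \<Longrightarrow> y < x + L - 2 \<Longrightarrow> f x \<noteq> f y"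
  unfolding f_def by (rule cross) auto

lemma f_eqD: "f x = f y \<Longrightarrow> \<bar>x - y\<bar> \<le> 3 \<Longrightarrow> x = y"
  using f_neq_f[of x y] f_neq_f[of y x] h_ge by (cases x y rule: linorder_cases) auto

lemma f_neq_t: "x < s \<Longrightarrow> s < x + L - 2 \<Longrightarrow> f x \<noteq> t s"
  unfolding f_def t_def by (rule cross) auto

lemma f_neq_t': "x - L < s \<Longrightarrow> s < x - 2 \<Longrightarrow> f x \<noteq> t s"
  unfolding f_def t_def by (rule cross[symmetric]) auto

lemma e_neq_t: "x < s \<Longrightarrow> s < x + L - 1 \<Longrightarrow> e x \<noteq> t s"
  unfolding e_def t_def by (rule cross) auto

lemma e_neq_t': "x - L < s \<Longrightarrow> s < x - 1 \<Longrightarrow> e x \<noteq> t s"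
  unfolding e_def t_def by (rule cross[symmetric]) auto

lemma e_neq_f: "e x \<noteq> f (x + 2)" "e (x + 1) \<noteq> f x"
  using h_ge cross[of x "x + 2" "x + L - 1" "x + L"] cross[of x "x + 1" "x + L - 2" "x + L"]
  by (simp_all add: e_def f_def algebra_simps)

text \<open>A step of \<open>L = 5 * h + 2\<close> crosses \<open>h\<close> group boundaries if the
  residue of \<open>x\<close> is at most 2 and \<open>h + 1\<close> otherwise. The residue thus
  decides on which side of the diagonal the centre lies.\<close>

lemma r_neq_t: "x mod 5 \<le> 2 \<Longrightarrow> x < y \<Longrightarrow> y < x + L \<Longrightarrow> r y \<noteq> t x"
  unfolding t_def by (rule hide) (simp_all, presburger)

text \<open>The \<open>2 * h + 1\<close> groups leave at most \<open>h\<close> group steps on the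
  complementary arc from \<open>j\<close> to \<open>i + m\<close>, so that arc is the hidden
  one.\<close>

lemma hide': "i < j \<Longrightarrow> j < y \<Longrightarrow> y < i + m \<Longrightarrow> i div 5 + h < j div 5 \<Longrightarrow> r y \<noteq> c i j"
  using hide[of j y "i + m"] c_wrap[of j i] by (auto simp: algebra_simps)

lemma r_neq_t': "3 \<le> x mod 5 \<Longrightarrow> x + L < y \<Longrightarrow> y < x + m \<Longrightarrow> r y \<noteq> t x"
  unfolding t_def using h_ge by (intro hide') (simp_all, presburger)

lemma r_neq_f: "x < y \<Longrightarrow> y < x + L - 2 \<Longrightarrow> r y \<noteq> f x"
  unfolding f_def by (rule hide) auto

lemma r_neq_e: "x mod 5 \<le> 3 \<Longrightarrow> x < y \<Longrightarrow> y < x + L - 1 \<Longrightarrow> r y \<noteq> e x"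
  unfolding e_def by (rule hide) (simp_all, presburger)

lemma r_neq_e': "x mod 5 = 4 \<Longrightarrow> x + L - 1 < y \<Longrightarrow> y < x + m \<Longrightarrow> r y \<noteq> e x"
  unfolding e_def using h_ge by (intro hide') (simp_all, presburger)

lemma t_eqD:
  assumes "t x = t y" "x \<le> y" "y < x + m"
  shows "y = x \<or> y = x + L \<or> y = x + L + 1"
proof (rule ccontr)
  assume "\<not> ?thesis"
  then consider "x < y" "y < x + L" | "x + L + 1 < y" "y < x + m" using assms by linarith
  then show False
    by cases (use assms t_neq_t[of x y] t_neq_t[of y "x + m"] t_period[of x] in auto)
qed

section \<open>Pairing the longest diagonals into wedges\<close>

lemma t_pairing:
  obtains w where "\<And>p. w < p \<Longrightarrow> p \<le> w + L \<Longrightarrow> t p = t (p + L + 1)"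
    and "\<And>y. w + L + 1 < y \<Longrightarrow> y < w + L + 1 + m \<Longrightarrow> t y \<noteq> t (w + L + 1)"
    and "t ` {0..<m} = C"
proof -
  define R where "R = {0..<m}"
  \<comment> \<open>\<open>P\<close> holds the residues that share their colour with the diagonal
    starting \<open>L\<close> further on, and \<open>Q\<close> holds those later partners.\<close>
  define P where "P = {x \<in> R. t x = t (x + L)}"
  define Q where "Q = (\<lambda>x. (x + L) mod m) ` P"
  have cardR: "int (card R) = m" and finR: "finite R" using h_ge by (auto simp: R_def)
  \<comment> \<open>Modulo \<open>m\<close>, \<open>y + 2 * L\<close> is \<open>y - 1\<close>, and
    neighbouring longest diagonals cross. Hence colour classes do not chain beyond two
    members.\<close>
  have no3: "t y \<noteq> t (y + 2 * L)" for y
    using t_eqD[of y "y + 2 * L"] h_ge by auto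
  have PR: "P \<subseteq> R" and QR: "Q \<subseteq> R" using h_ge by (auto simp: P_def Q_def R_def)
  have finP: "finite P" "finite Q" using PR QR finR finite_subset by auto
  have Pmod: "x mod m \<in> P \<longleftrightarrow> t x = t (x + L)" for x
    using h_ge t_mod[of x] t_mod[of "x + L"] t_mod[of "x mod m + L"]
    by (auto simp: P_def R_def mod_add_left_eq)
  have Qmod: "x mod m \<in> Q \<longleftrightarrow> t (x - L) = t x" for x
  proof
    assume "x mod m \<in> Q"
    then obtain y where y: "y \<in> P" "x mod m = (y + L) mod m" by (auto simp: Q_def)
    then have "(x - L) mod m = y mod m" by (simp add: mod_eq_dvd_iff algebra_simps)
    also have "y mod m = y" using y(1) PR by (auto simp: R_def)
    finally show "t (x - L) = t x" using Pmod[of "x - L"] y(1) by simp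
  next
    assume "t (x - L) = t x"
    then have "(x - L) mod m \<in> P" using Pmod[of "x - L"] by simp
    moreover have "((x - L) mod m + L) mod m = x mod m" by (simp add: mod_add_left_eq)
    ultimately show "x mod m \<in> Q" unfolding Q_def by (intro image_eqI[of _ _ "(x - L) mod m"]) simp_all
  qed
  have mod_R: "x mod m = x" if "x \<in> R" for x using that by (auto simp: R_def)
  have disj: "P \<inter> Q = {}"
  proof (rule equals0I)
    fix x assume x: "x \<in> P \<inter> Q"
    then have "x mod m = x" using PR mod_R by auto
    then have "t x = t (x + L)" "t (x - L) = t x" using Pmod[of x] Qmod[of x] x by auto
    then show False using no3[of "x - L"] by (simp add: algebra_simps)
  qed
  have "inj_on (\<lambda>x. (x + L) mod m) P"
  proof (rule inj_onI)
    fix x y assume xy: "x \<in> P" "y \<in> P" "(x + L) mod m = (y + L) mod m"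
    then have "x mod m = y mod m" by (simp add: mod_eq_dvd_iff)
    then show "x = y" using mod_R[of x] mod_R[of y] xy PR by auto
  qed
  then have cardQ: "card Q = card P" unfolding Q_def by (rule card_image)
  \<comment> \<open>Removing \<open>P\<close> leaves one representative of each colour class. With
    only \<open>L + 1\<close> colours this forces \<open>card P\<close> up to \<open>L\<close>,
    while disjointness from \<open>Q\<close> bounds it by \<open>L\<close>, so one residue
    \<open>x0\<close> stays unpaired.\<close>
  have inj: "inj_on t (R - P)"
  proof (rule linorder_inj_onI')
    fix x y assume xy: "x \<in> R - P" "y \<in> R - P" "x < y"
    show "t x \<noteq> t y"
    proof
      assume eq: "t x = t y"
      have "y = x + L \<or> y = x + L + 1" using t_eqD[OF eq] xy by (auto simp: R_def)
      then show False
      proof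
        assume "y = x + L" then show False using xy eq by (auto simp: P_def)
      next
        assume "y = x + L + 1"
        then have "t (y + L) = t y" using eq t_period[of x] by (simp add: algebra_simps)
        then show False using xy by (auto simp: P_def)
      qed
    qed
  qed
  have sub: "t ` (R - P) \<subseteq> C" using t_in by auto
  have cardRP: "card (t ` (R - P)) = card R - card P"
    using card_image[OF inj] card_Diff_subset[OF finP(1) PR] by simp
  have "card R - card P \<le> card C" using card_mono[OF finite_C sub] cardRP by simp
  then have ge: "int (card P) \<ge> L" using cardR card_C by linarith
  have cardPQ: "card (P \<union> Q) = 2 * card P" using card_Un_disjoint[OF finP disj] cardQ by simp
  have PQR: "P \<union> Q \<subseteq> R" using PR QR by auto
  have "2 * card P \<le> card R" using card_mono[OF finR PQR] cardPQ by simp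
  then have cardP: "int (card P) = L" using ge cardR by linarith
  have surj: "t ` (R - P) = C"
    by (rule card_subset_eq[OF finite_C sub]) (use cardRP cardR cardP card_C in linarith)
  have "card (R - (P \<union> Q)) = 1"
    using card_Diff_subset[of "P \<union> Q" R] finP PQR cardPQ cardR cardP by simp
  then obtain x0 where x0: "R - (P \<union> Q) = {x0}" by (auto simp: card_1_singleton_iff)
  have x0R: "x0 \<in> R" "x0 mod m = x0" using x0 mod_R by auto
  have x0_not: "t x0 \<noteq> t (x0 + L)" "t (x0 - L) \<noteq> t x0"
    using Pmod[of x0] Qmod[of x0] x0 x0R by auto
  have other: "t z = t (z + L) \<or> t (z - L) = t z" if "z mod m \<noteq> x0" for z
  proof -
    have "z mod m \<in> R" using h_ge by (auto simp: R_def)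
    then show ?thesis using that x0 Pmod[of z] Qmod[of z] by auto
  qed
  have not_x0: "z mod m \<noteq> x0" if "x0 < z" "z < x0 + m" for z
  proof
    assume "z mod m = x0"
    then have "m dvd z - x0" using x0R mod_eq_dvd_iff[of z m x0] by simp
    then show False using that zdvd_not_zless[of "z - x0" m] by simp
  qed
  \<comment> \<open>The pairing propagates from \<open>x0\<close>: if \<open>?y\<close> is paired
    with \<open>?y + L\<close>, then \<open>?y - 1\<close>, which is \<open>?y + 2 * L\<close>
    modulo \<open>m\<close>, must look for its partner in the other direction.\<close>
  have down: "t (x0 + L - int i) = t (x0 + L - int i + L)" if "int i < L" for i
    using that
  proof (induction i)
    case 0
    then show ?case using other[of "x0 + L"] not_x0[of "x0 + L"] x0_not h_ge by auto
  next
    case (Suc i)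
    let ?y = "x0 + L - int i"
    have IH: "t ?y = t (?y + L)" using Suc by simp
    have "t (?y - 1) = t (?y - 1 + L) \<or> t (?y - 1 - L) = t (?y - 1)"
      by (rule other, rule not_x0) (use Suc.prems h_ge in auto)
    moreover have "t (?y - 1 - L) = t (?y + L)" "t (?y - 1) = t (?y + 2 * L)"
      using t_period[of "?y - 1 - L"] t_period[of "?y - 1"] by (simp_all add: algebra_simps)
    ultimately have "t (?y - 1) = t (?y - 1 + L)" using IH no3[of ?y] by auto
    then show ?case by (simp add: algebra_simps)
  qed
  show thesis
  \<comment> \<open>With this choice \<open>w + L + 1 = x0 + m\<close>, so the lone index is
    \<open>x0\<close> up to the period.\<close>
  proof (rule that[of "x0 + L"])
    fix p assume p: "x0 + L < p" "p \<le> x0 + L + L"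
    have "t (p - L) = t p" using down[of "nat (x0 + 2 * L - p)"] p by (simp add: algebra_simps)
    then show "t p = t (p + L + 1)" using t_period[of "p - L"] by (simp add: algebra_simps)
  next
    fix y assume y: "x0 + L + L + 1 < y" "y < x0 + L + L + 1 + m"
    have w: "t (x0 + L + L + 1) = t x0" using t_period[of x0] by (simp add: algebra_simps)
    show "t y \<noteq> t (x0 + L + L + 1)"
    proof
      assume "t y = t (x0 + L + L + 1)"
      then have eq: "t (x0 + m) = t y" using w t_period[of x0] by simp
      then have "y = x0 + m + L \<or> y = x0 + m + L + 1" using t_eqD[OF eq] y by auto
      then show False
      proof
        assume "y = x0 + m + L"
        then show False using eq x0_not(1) t_period[of x0] t_period[of "x0 + L"]
          by (simp add: algebra_simps)
      next
        assume "y = x0 + m + L + 1"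
        then show False using eq x0_not(2) t_period[of x0] t_period[of "x0 - L"]
            t_period[of "x0 - L + m"]
          by (simp add: algebra_simps)
      qed
    qed
  next
    show "t ` {0..<m} = C" using surj t_in by (auto simp: R_def)
  qed
qed

end

text \<open>The diagonal \<open>(w + L + 1, w + 2 L + 1)\<close> is the longest diagonal whose colour occurs on no other
  longest diagonal; all other colours occur on a wedge with apex in \<open>{w<..w + L}\<close>.\<close>

locale paired_wheel_colouring = wheel_colouring +
  fixes w :: int
  assumes apex: "\<And>p. w < p \<Longrightarrow> p \<le> w + L \<Longrightarrow> t p = t (p + L + 1)"
    and lone: "\<And>y. w + L + 1 < y \<Longrightarrow> y < w + L + 1 + m \<Longrightarrow> t y \<noteq> t (w + L + 1)"
    and t_surj: "t ` {0..<m} = C"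
begin

section \<open>Slots of the shorter diagonals\<close>

lemma t_representative:
  assumes "a \<in> C"
  obtains s where "t s = a" "z \<le> s" "s < z + m"
proof -
  obtain s where s: "t s = a" using assms t_surj by auto
  let ?s = "z + (s - z) mod m"
  have "?s mod m = s mod m" by (simp add: mod_add_right_eq)
  then have "t ?s = a" using s t_mod[of s] t_mod[of ?s] by simp
  moreover have "0 \<le> (s - z) mod m" "(s - z) mod m < m" using h_ge by simp_all
  ultimately show thesis by (intro that[of ?s]) linarith+
qed

text \<open>Up to the period, every index but the lone one is the first index \<open>p\<close> or
  the second index \<open>p + L + 1\<close> of a wedge with \<open>w < p\<close> and
  \<open>p \<le> w + L\<close>.\<close>

lemma partner:
  assumes "w + L + 1 - m < s" "s < w + L + 1 + m" "s \<noteq> w + L + 1"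
  shows "t s = t (s + L) \<or> t s = t (s + L + 1)"
proof -
  have *: "t s = t (s + L) \<or> t s = t (s + L + 1)" if "w + L + 1 < s" "s < w + L + 1 + m" for s
  proof (cases "s \<le> w + m")
    case True
    then have "t (s - L - 1) = t s" using apex[of "s - L - 1"] that by simp
    then show ?thesis using t_period[of "s - L - 1"] by (simp add: algebra_simps)
  next
    case False
    then have "t (s - m) = t (s - m + L + 1)" using apex[of "s - m"] that by simp
    then show ?thesis using t_period'[of s] t_period'[of "s + L + 1"] by (simp add: algebra_simps)
  qed
  show ?thesis
  proof (cases "w + L + 1 < s")
    case True then show ?thesis using * assms by blast
  next
    case False
    then have "t (s + m) = t (s + m + L) \<or> t (s + m) = t (s + m + L + 1)"
      using *[of "s + m"] assms by simp
    then show ?thesis using t_period[of s] t_period[of "s + L"] t_period[of "s + L + 1"]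
      by (simp add: algebra_simps)
  qed
qed

lemma partner_mod:
  assumes "s mod m \<noteq> (w + L + 1) mod m"
  shows "t s = t (s + L) \<or> t s = t (s + L + 1)"
proof -
  define d where "d = (s - (w + L + 1)) mod m"
  define s' where "s' = w + L + 1 + d"
  have s': "s' mod m = s mod m" by (simp add: s'_def d_def mod_add_right_eq)
  have "0 \<le> d" "d < m" using h_ge by (simp_all add: d_def)
  moreover have "d \<noteq> 0" using assms s' by (auto simp: s'_def)
  ultimately have "t s' = t (s' + L) \<or> t s' = t (s' + L + 1)"
    by (intro partner) (auto simp: s'_def)
  moreover have "t (s' + z) = t (s + z)" for z
    using t_mod[of "s' + z"] t_mod[of "s + z"] mod_add_cong[OF s' refl, of z] by simp
  from this[of 0] this[of L] this[of "L + 1"]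
  have "t s' = t s" "t (s' + L) = t (s + L)" "t (s' + L + 1) = t (s + L + 1)"
    by (simp_all add: add.assoc)
  ultimately show ?thesis by simp
qed

text \<open>We say that \<open>f x\<close> occupies the slot \<open>s\<close> if \<open>t s = f x\<close> and the diagonal of \<open>f x\<close> lies on the
  side \<open>{s..s + L}\<close> of the longest diagonal \<open>(s, s + L)\<close>.  The other side of the unpaired longest
  diagonal is no slot, which accounts for the second alternative.\<close>

lemma f_slot:
  assumes "w \<le> x" "x \<le> w + 2 * L"
  shows "(\<exists>s. x - 2 \<le> s \<and> s \<le> x \<and> t s = f x) \<or> x \<le> w + 3 \<and> f x = t (w + L + 1)"
proof -
  \<comment> \<open>Within this window, every position of \<open>s\<close> outside
    \<open>{x - 2..x}\<close> makes the two diagonals cross.\<close>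
  have near: "x - 2 \<le> s \<and> s \<le> x" if "t s = f x" "x - L < s" "s < x + L - 2" for s
    using f_neq_t[of x s] f_neq_t'[of x s] that by (metis not_less)
  obtain s where s: "t s = f x" "x - 2 \<le> s" "s < x - 2 + m"
    using t_representative[OF f_in] by metis
  show ?thesis
  proof (cases "s < x + L - 2")
    case True
    then show ?thesis using near[OF s(1)] s h_ge by auto
  next
    case False
    have up: "s \<le> x + L + 1"
    proof (rule ccontr)
      assume "\<not> s \<le> x + L + 1"
      then show False using near[of "s - m"] s t_period'[of s] by simp
    qed
    show ?thesis
    \<comment> \<open>Here the diagonal of \<open>f x\<close> lies on the wrong side of
      \<open>(s, s + L)\<close>. Unless \<open>s\<close> is the lone index, the other arm of its
      wedge falls into the window of \<open>near\<close>.\<close>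
    proof (cases "s = w + L + 1")
      case True
      then show ?thesis using s False by auto
    next
      case neq: False
      have "t s = t (s + L) \<or> t s = t (s + L + 1)"
        by (rule partner) (use neq False up assms h_ge in auto)
      then have "t (s - L - 1) = f x \<or> t (s - L) = f x"
        using s(1) t_period'[of "s + L"] t_period'[of "s + L + 1"] by (auto simp: algebra_simps)
      then show ?thesis
      proof
        assume a: "t (s - L - 1) = f x"
        have "x - 2 \<le> s - L - 1 \<and> s - L - 1 \<le> x"
          by (rule near[OF a]) (use False up h_ge in auto)
        then show ?thesis using a by blast
      next
        assume a: "t (s - L) = f x"
        have "x - 2 \<le> s - L \<and> s - L \<le> x"
          by (rule near[OF a]) (use False up h_ge in auto)
        then show ?thesis using a by blast
      qed
    qed
  qed
qed

text \<open>The argument is that for \<open>f\<close>, with one position fewer. The bound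
  \<open>w + 3 \<le> x\<close> keeps the lone index out of reach.\<close>

lemma e_slot:
  assumes "w + 3 \<le> x" "x \<le> w + 2 * L"
  shows "e x = t x \<or> e x = t (x - 1)"
proof -
  have near: "s = x - 1 \<or> s = x" if "t s = e x" "x - L < s" "s < x + L - 1" for s
    using e_neq_t[of x s] e_neq_t'[of x s] that by (metis antisym_conv1 linorder_not_le zle_diff1_eq)
  obtain s where s: "t s = e x" "x - 1 \<le> s" "s < x - 1 + m"
    using t_representative[OF e_in] by metis
  show ?thesis
  proof (cases "s < x + L - 1")
    case True
    then show ?thesis using near[OF s(1)] s h_ge by auto
  next
    case False
    have up: "s \<le> x + L + 1"
    proof (rule ccontr)
      assume "\<not> s \<le> x + L + 1"
      then show False using near[of "s - m"] s t_period'[of s] by simp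
    qed
    have "t s = t (s + L) \<or> t s = t (s + L + 1)"
      by (rule partner) (use False up assms h_ge in auto)
    then have "t (s - L - 1) = e x \<or> t (s - L) = e x"
      using s(1) t_period'[of "s + L"] t_period'[of "s + L + 1"] by (auto simp: algebra_simps)
    then show ?thesis
    proof
      assume a: "t (s - L - 1) = e x"
      have "s - L - 1 = x - 1 \<or> s - L - 1 = x"
        by (rule near[OF a]) (use False up h_ge in auto)
      then show ?thesis using a by metis
    next
      assume a: "t (s - L) = e x"
      have "s - L = x - 1 \<or> s - L = x"
        by (rule near[OF a]) (use False up h_ge in auto)
      then show ?thesis using a by metis
    qed
  qed
qed

text \<open>The \<open>m\<close> diagonals \<open>f x\<close> occupy distinct slots, apart from at
  most one of the lone colour. Once one slot is empty, the other \<open>m - 1\<close> must all be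
  filled and the exception must occur.\<close>

lemma slots_exact:
  assumes empty: "\<And>x. sH \<le> x \<Longrightarrow> x \<le> sH + 2 \<Longrightarrow> f x \<noteq> t sH"
  shows "\<exists>x. w \<le> x \<and> x \<le> w + 3 \<and> f x = t (w + L + 1)"
    and "s mod m \<noteq> sH mod m \<Longrightarrow> \<exists>x. s \<le> x \<and> x \<le> s + 2 \<and> f x = t s"
proof -
  define E where "E = {w..w + 2 * L}"
  define E' where "E' = {x \<in> E. \<exists>s. x - 2 \<le> s \<and> s \<le> x \<and> t s = f x}"
  define \<sigma> where "\<sigma> x = (SOME s. x - 2 \<le> s \<and> s \<le> x \<and> t s = f x)" for x
  define N where "N = {0..<m} - {sH mod m}"
  have \<sigma>: "x - 2 \<le> \<sigma> x" "\<sigma> x \<le> x" "t (\<sigma> x) = f x" if "x \<in> E'" for x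
  proof -
    have "\<exists>s. x - 2 \<le> s \<and> s \<le> x \<and> t s = f x" using that by (auto simp: E'_def)
    from someI_ex[OF this] show "x - 2 \<le> \<sigma> x" "\<sigma> x \<le> x" "t (\<sigma> x) = f x"
      by (simp_all add: \<sigma>_def)
  qed
  have shift: "f (x + m * i) = f x" for x i
  proof -
    have *: "f (y + m * int i) = f y" for y i
      by (induction i) (use f_period[of "y + m * int i" for i] in \<open>auto simp: algebra_simps\<close>)
    show ?thesis
      using *[of x "nat i"] *[of "x + m * i" "nat (- i)"] by (cases "i \<ge> 0") auto
  qed
  \<comment> \<open>Occupation of a slot is invariant under the period, so a witness can be
    translated to any representative \<open>s\<close>.\<close>
  have moved: "\<exists>x'. s \<le> x' \<and> x' \<le> s + 2 \<and> f x' = t s" if "x \<in> E'" "\<sigma> x mod m = s mod m" for x s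
  proof -
    from that(2) obtain i where i: "s = \<sigma> x + m * i" by (metis mod_eqE)
    have eq: "t s = t (\<sigma> x)" using that(2) t_mod[of s] t_mod[of "\<sigma> x"] by simp
    show ?thesis
      using \<sigma>[OF that(1)] eq shift[of x i] i by (intro exI[of _ "x + m * i"]) simp
  qed
  have range: "(\<lambda>x. \<sigma> x mod m) ` E' \<subseteq> N"
  proof
    fix z assume "z \<in> (\<lambda>x. \<sigma> x mod m) ` E'"
    then obtain x where x: "x \<in> E'" "z = \<sigma> x mod m" by blast
    have "z \<noteq> sH mod m" using moved[OF x(1), of sH] x(2) empty by metis
    then show "z \<in> N" using x h_ge by (simp add: N_def)
  qed
  have inj: "inj_on (\<lambda>x. \<sigma> x mod m) E'"
  proof (rule inj_onI)
    fix x y assume xy: "x \<in> E'" "y \<in> E'" "\<sigma> x mod m = \<sigma> y mod m"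
    obtain i where i: "\<sigma> y = \<sigma> x + m * i" using xy(3) by (metis mod_eqE)
    have eq: "f (x + m * i) = f y"
      using shift[of x i] \<sigma>(3)[OF xy(1)] \<sigma>(3)[OF xy(2)] t_mod[of "\<sigma> x"] t_mod[of "\<sigma> y"] xy(3)
      by simp
    define z where "z = x + m * i"
    have "z - x = \<sigma> y - \<sigma> x" "f z = f y" using i eq by (simp_all add: z_def)
    then have "z = y"
      using \<sigma>(1,2)[OF xy(1)] \<sigma>(1,2)[OF xy(2)] by (intro f_eqD) auto
    then have dvd: "m dvd y - x" "m dvd x - y" by (auto simp: z_def dvd_diff_commute)
    have "\<bar>x - y\<bar> < m" using xy(1,2) by (auto simp: E'_def E_def)
    then show "x = y"
      using zdvd_not_zless[of "y - x" m] zdvd_not_zless[of "x - y" m] dvd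
      by (cases x y rule: linorder_cases) auto
  qed
  have finE: "finite E" "card E = nat m" by (simp_all add: E_def)
  have finE': "finite E'" using finE by (auto simp: E'_def)
  have finN: "finite N" "card N = nat m - 1" using h_ge by (auto simp: N_def card_Diff_subset)
  have lone_f: "w \<le> x \<and> x \<le> w + 3 \<and> f x = t (w + L + 1)" if "x \<in> E - E'" for x
    using f_slot[of x] that by (auto simp: E_def E'_def)
  have "card E' \<le> nat m - 1" using card_inj_on_le[OF inj range finN(1)] finN(2) by simp
  then have "E' \<noteq> E" using finE h_ge by auto
  then obtain x where "x \<in> E - E'" by (auto simp: E'_def)
  then show "\<exists>x. w \<le> x \<and> x \<le> w + 3 \<and> f x = t (w + L + 1)" using lone_f by blast
  \<comment> \<open>Diagonals without a slot start in \<open>{w..w + 3}\<close> and share the lone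
    colour; starts that close cross unless equal.\<close>
  have "card (E - E') \<le> card {x}"
  proof (rule card_mono)
    have "y = x" if "y \<in> E - E'" for y
      using lone_f[OF that] lone_f[OF \<open>x \<in> E - E'\<close>] by (intro f_eqD) auto
    then show "E - E' \<subseteq> {x}" by blast
  qed simp
  then have "card E' \<ge> nat m - 1"
    using card_Diff_subset[of E' E] finE' finE by (auto simp: E'_def)
  then have im: "(\<lambda>x. \<sigma> x mod m) ` E' = N"
    using card_image[OF inj] finN by (intro card_seteq range) auto
  then show "\<exists>x. s \<le> x \<and> x \<le> s + 2 \<and> f x = t s" if "s mod m \<noteq> sH mod m"
  proof -
    have "s mod m \<in> N" using that h_ge by (auto simp: N_def)
    then have "s mod m \<in> (\<lambda>x. \<sigma> x mod m) ` E'" by (simp only: im)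
    then obtain x where "s mod m = \<sigma> x mod m" "x \<in> E'" by (rule imageE)
    then show ?thesis by (intro moved) simp_all
  qed
qed

text \<open>The \<open>L - 2\<close> slots in \<open>{u + 2..u + L}\<close> other than the empty slot \<open>sH\<close> are the only ones
  available to the \<open>L - 3\<close> diagonals \<open>f (u + 4), \<dots>, f (u + L)\<close>, so at most one of the four
  diagonals in the conclusion can be in such a slot.\<close>

lemma dichotomy:
  assumes u: "w + 3 \<le> u" "u \<le> w + L - 3"
    and sH: "u + 2 \<le> sH" "sH \<le> u + L"
    and empty: "\<And>x. sH \<le> x \<Longrightarrow> x \<le> sH + 2 \<Longrightarrow> f x \<noteq> t sH"
  shows "f (u + L + 1) = t (u + L + 1) \<and> f (u + L + 2) = t (u + L + 2) \<or>
    f (u + 2) = t u \<and> f (u + 3) = t (u + 1)"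
proof -
  define \<sigma> where "\<sigma> x = (SOME s. x - 2 \<le> s \<and> s \<le> x \<and> t s = f x)" for x
  define M where "M = {u + 2..u + L} - {sH}"
  define X where "X = {x \<in> {u + 2..u + L + 2}. \<sigma> x \<in> M}"
  have \<sigma>: "x - 2 \<le> \<sigma> x" "\<sigma> x \<le> x" "t (\<sigma> x) = f x" "\<sigma> x \<noteq> sH"
    if "x \<in> {u + 2..u + L + 2}" for x
  proof -
    \<comment> \<open>The exceptional alternative of \<open>f_slot\<close> needs
      \<open>x \<le> w + 3\<close>, but here \<open>x\<close> is at least \<open>u + 2\<close>,
      which exceeds it.\<close>
    have "\<exists>s. x - 2 \<le> s \<and> s \<le> x \<and> t s = f x" using f_slot[of x] that u by auto
    from someI_ex[OF this] show *: "x - 2 \<le> \<sigma> x" "\<sigma> x \<le> x" "t (\<sigma> x) = f x"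
      by (simp_all add: \<sigma>_def)
    show "\<sigma> x \<noteq> sH" using * empty[of x] by auto
  qed
  have inj: "x = y"
    if "x \<in> {u + 2..u + L + 2}" "y \<in> {u + 2..u + L + 2}" "\<sigma> x = \<sigma> y" for x y
    using \<sigma>[OF that(1)] \<sigma>[OF that(2)] that(3) by (intro f_eqD) auto
  have "inj_on \<sigma> X" by (rule inj_onI, rule inj) (simp_all add: X_def)
  then have "card X \<le> card M"
    by (rule card_inj_on_le) (auto simp: X_def M_def)
  also have "card M = nat (L - 2)" using sH by (simp add: M_def card_Diff_subset)
  finally have card_X: "card X \<le> nat (L - 2)" .
  have inner: "{u + 4..u + L} \<subseteq> X"
  proof
    fix x assume "x \<in> {u + 4..u + L}"
    then show "x \<in> X" using \<sigma>[of x] by (auto simp: X_def M_def)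
  qed
  have one: False if "x \<in> X" "y \<in> X" "x \<noteq> y" "x \<notin> {u + 4..u + L}" "y \<notin> {u + 4..u + L}" for x y
  proof -
    have "card (insert x (insert y {u + 4..u + L})) \<le> card X"
    proof (rule card_mono)
      show "finite X" by (rule finite_subset[of _ "{u + 2..u + L + 2}"]) (auto simp: X_def)
      show "insert x (insert y {u + 4..u + L}) \<subseteq> X" using inner that(1,2) by blast
    qed
    then show False using that card_X h_ge by simp
  qed
  show ?thesis
  proof (cases "u + L + 1 \<in> X \<or> u + L + 2 \<in> X")
    case False
    \<comment> \<open>Neither index uses a slot of \<open>M\<close> and \<open>sH\<close> is empty,
      so both slots lie beyond \<open>u + L\<close>; injectivity then separates them.\<close>
    have 1: "\<sigma> (u + L + 1) = u + L + 1"
      using \<sigma>[of "u + L + 1"] False h_ge by (auto simp: X_def M_def)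
    have "\<sigma> (u + L + 2) \<noteq> u + L + 1" using inj[of "u + L + 1" "u + L + 2"] 1 h_ge by auto
    then have "\<sigma> (u + L + 2) = u + L + 2"
      using \<sigma>[of "u + L + 2"] False h_ge by (auto simp: X_def M_def)
    then show ?thesis using 1 \<sigma>(3)[of "u + L + 1"] \<sigma>(3)[of "u + L + 2"] h_ge by simp
  next
    case True
    have no: "u + 2 \<notin> X" "u + 3 \<notin> X"
      using True one[of "u + L + 1" "u + 2"] one[of "u + L + 2" "u + 2"]
        one[of "u + L + 1" "u + 3"] one[of "u + L + 2" "u + 3"] h_ge by auto
    have 1: "\<sigma> (u + 3) = u + 1" using \<sigma>[of "u + 3"] no h_ge by (auto simp: X_def M_def)
    have "\<sigma> (u + 2) \<noteq> u + 1" using inj[of "u + 2" "u + 3"] 1 h_ge by auto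
    then have "\<sigma> (u + 2) = u"
      using \<sigma>[of "u + 2"] no h_ge by (auto simp: X_def M_def)
    then show ?thesis using 1 \<sigma>(3)[of "u + 2"] \<sigma>(3)[of "u + 3"] h_ge by simp
  qed
qed

text \<open>The possible positions of a spoke relative to the longest diagonals of its colour: either
  one of these has the centre and \<open>y\<close> on the side \<open>{s..s + L}\<close>, or the colour is the unpaired one
  with the centre on the other side, or the centre lies inside a wedge, whose apex has residue \<open>2\<close>
  and whose other endpoints have residues \<open>0\<close> and \<open>4\<close>.\<close>

lemma visible_cases:
  obtains (side) s where "r y = t s" "3 \<le> s mod 5" "s \<le> y" "y \<le> s + L"
  | (far) s where "r y = t s" "s mod m = (w + L + 1) mod m" "s mod 5 \<le> 2" "s + L \<le> y" "y \<le> s + m"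
  | (wedge) "y mod 5 \<noteq> 1" "y mod 5 \<noteq> 3" "y mod 5 = 2 \<Longrightarrow> t y = t (y - L)"
proof -
  obtain s where s: "t s = r y" "y - m \<le> s" "s < y - m + m"
    using t_representative[OF r_in] by metis
  have res: "(s + m) mod 5 = s mod 5" "(s + L) mod 5 = (s + 2) mod 5"
    "(s + L + 1) mod 5 = (s + 3) mod 5" by presburger+
  show thesis
  proof (cases "s mod 5 \<le> 2")
    \<comment> \<open>The centre lies on the side \<open>{s..s + L}\<close>, so a visible
      \<open>y\<close> is there too.\<close>
    case False
    have "\<not> (s + L < y \<and> y < s + m)" using r_neq_t'[of s y] s(1) False by auto
    then have "y \<le> s + L \<or> y = s + m" using s(2) by linarith
    then show thesis
    proof
      assume "y \<le> s + L"
      then show thesis by (intro side[of s]) (use s False in simp_all)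
    next
      assume "y = s + m"
      then show thesis by (intro side[of "s + m"]) (use s(1) False res(1) t_period[of s] h_ge in simp_all)
    qed
  next
    case True
    have "\<not> y < s + L" using r_neq_t[of s y] s True by auto
    then have y: "s + L \<le> y" "y \<le> s + m" using s(2) by linarith+
    show thesis
    proof (cases "s mod m = (w + L + 1) mod m")
      case True
      then show thesis using far[of s] s y \<open>s mod 5 \<le> 2\<close> by simp
    next
      case False
      from partner_mod[OF this] show thesis
      proof
        assume p: "t s = t (s + L)"
        \<comment> \<open>Only residue 0 puts the centre inside the wedge with apex
          \<open>s + L\<close>; otherwise the second arm has the centre and \<open>y\<close> on its
          slot side.\<close>
        show thesis
        proof (cases "s mod 5 = 0")
          case s0: True
          have "(s + L) mod 5 = 2" using s0 by presburger
          then have "r y \<noteq> t (s + L)" if "s + L < y" "y < s + L + L"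
            by (intro r_neq_t that) simp
          then have "\<not> (s + L < y \<and> y < s + L + L)" using s(1) p by auto
          then have "y = s + L \<or> y = s + 2 * L \<or> y = s + m" using y by auto
          then show thesis
          proof (elim disjE)
            assume y': "y = s + L"
            then have "y mod 5 = 2" using s0 by presburger
            then show thesis by (intro wedge) (use y' p in simp_all)
          next
            assume "y = s + 2 * L"
            then have "y mod 5 = 0 \<or> y mod 5 = 4" using s0 by presburger
            then show thesis by (intro wedge) auto
          next
            assume "y = s + m"
            then have "y mod 5 = 0 \<or> y mod 5 = 4" using s0 by presburger
            then show thesis by (intro wedge) auto
          qed
        next
          case s12: False
          have "3 \<le> (s + L) mod 5" using s12 True by presburger
          then have "\<not> (s + L + L < y \<and> y < s + L + m)"
            using r_neq_t'[of "s + L" y] s(1) p by auto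
          then have "y \<le> s + L + L" using y h_ge by linarith
          then show thesis
            by (intro side[of "s + L"] \<open>3 \<le> (s + L) mod 5\<close>) (use s(1) p y in simp_all)
        qed
      next
        assume p: "t s = t (s + L + 1)"
        \<comment> \<open>Now the apex is \<open>s\<close>, so residue 2 is the one that puts the
          centre inside the wedge.\<close>
        show thesis
        proof (cases "s mod 5 = 2")
          case s2: True
          have "(s + L + 1) mod 5 = 0" using s2 by presburger
          then have "r y \<noteq> t (s + L + 1)" if "s + L + 1 < y" "y < s + L + 1 + L"
            by (intro r_neq_t that) simp
          then have "\<not> (s + L + 1 < y \<and> y < s + L + 1 + L)" using s(1) p by auto
          then have "y = s + L \<or> y = s + L + 1 \<or> y = s + m" using y by auto
          then show thesis
          proof (elim disjE)
            assume "y = s + L"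
            then have "y mod 5 = 0 \<or> y mod 5 = 4" using s2 by presburger
            then show thesis by (intro wedge) auto
          next
            assume "y = s + L + 1"
            then have "y mod 5 = 0 \<or> y mod 5 = 4" using s2 by presburger
            then show thesis by (intro wedge) auto
          next
            assume eq: "y = s + m"
            have shift: "y - L = s + L + 1" using eq by simp
            have "t y = t s" using t_period[of s] by (simp only: eq)
            then have "t y = t (y - L)" using p by (simp only: shift)
            moreover have "y mod 5 = 2" using s2 eq by presburger
            ultimately show thesis by (intro wedge) simp_all
          qed
        next
          case s01: False
          have 3: "3 \<le> (s + L + 1) mod 5" "3 \<le> (s - L) mod 5" using s01 True by presburger+
          have shift: "s - L + m = s + L + 1" by simp
          have "t (s - L) = t s" using p t_period[of "s - L"] by (simp only: shift)
          then have "y \<noteq> s + L" using r_neq_t'[of "s - L" y] 3(2) s(1) h_ge by auto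
          then show thesis
            by (intro side[of "s + L + 1"] 3(1)) (use s(1) p y in simp_all)
        qed
      qed
    qed
  qed
qed

section \<open>The contradiction at two neighbouring apexes\<close>

lemma u_exists:
  obtains u where "u mod 5 = 4" "w + 3 \<le> u" "u \<le> w + L - 3"
proof
  \<comment> \<open>This is the first index from \<open>w + 3\<close> on that ends a group. The two
    margins are those that \<open>e_slot\<close> needs at \<open>u\<close> and at
    \<open>u + L + 3\<close>.\<close>
  define u where "u = w + 3 + (4 - (w + 3)) mod 5"
  show "u mod 5 = 4" unfolding u_def by presburger
  have "0 \<le> (4 - (w + 3)) mod 5" "(4 - (w + 3)) mod 5 \<le> 4" by presburger+
  then show "w + 3 \<le> u" "u \<le> w + L - 3" unfolding u_def using h_ge by linarith+
qed

lemma far_unique: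
  assumes "s mod m = (w + L + 1) mod m" "s + L \<le> y" "y \<le> s + m" "w < y" "y \<le> w + 2 * L"
  shows "s = w + L + 1 - m"
proof -
  have "(w + L + 1 - m) mod m = (w + L + 1) mod m" by (rule minus_mod_self2)
  then have "m dvd s - (w + L + 1 - m)"
    using assms(1) mod_eq_dvd_iff[of s m "w + L + 1 - m"] by metis
  moreover have "s - (w + L + 1 - m) < m" "- (s - (w + L + 1 - m)) < m"
    using assms(2-5) h_ge by (simp_all add: algebra_simps)
  then have "\<bar>s - (w + L + 1 - m)\<bar> < m" by (simp only: abs_less_iff)
  ultimately show ?thesis by (rule int_dvd_diff_eq)
qed

lemma contradiction: False
proof -
  obtain u where u5: "u mod 5 = 4" and u: "w + 3 \<le> u" "u \<le> w + L - 3"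
    by (rule u_exists)
  have res: "(u + L + 1) mod 5 = 2" "(u - 1) mod 5 = 3" "(u + 2) mod 5 = 1" "(u + 1) mod 5 = 0"
    "(u + L + 2) mod 5 = 3" "(u + L + 3) mod 5 = 4" "(u + L) mod 5 = 1" "(u - 1 - L) mod 5 = 1"
    using u5 by presburger+
  define a b d k where "a = t (u - 1)" and "b = t u" and "d = t (u + 1)" and "k = t (u + 2)"
  have tb: "t (u + L + 1) = b" and td: "t (u + L + 2) = d" and tk: "t (u + L + 3) = k"
    using apex[of u] apex[of "u + 1"] apex[of "u + 2"] u by (simp_all add: b_def d_def k_def algebra_simps)
  have distinct: "b \<noteq> d" using t_neq_t[of u "u + 1"] h_ge by (simp add: b_def d_def)
  \<comment> \<open>The unpaired colour is out of range, and a wedge around the centre with apex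
    \<open>u + L + 1\<close> would give \<open>b = d\<close>. So the spoke to the middle point has a
    slot.\<close>
  obtain sH where sH: "r (u + L + 1) = t sH" "3 \<le> sH mod 5" "u + 2 \<le> sH" "sH \<le> u + L"
  proof (cases rule: visible_cases[of "u + L + 1"])
    case (side s)
    have "s \<noteq> u + 1" "s \<noteq> u + L + 1"
      by (rule notI, use side(2) res(1,4) in simp)+
    then show ?thesis using side by (intro that[of s]) auto
  next
    case (far s)
    then have "s = w + L + 1 - m" using u by (intro far_unique[of s "u + L + 1"]) auto
    then show ?thesis using far(5) u by linarith
  next
    case wedge
    have "t (u + L + 1) = t (u + L + 1 - L)" by (rule wedge(3)) (rule res(1))
    then have "b = t (u + L + 1 - L)" using tb by simp
    then show ?thesis using distinct by (simp add: d_def add.commute)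
  qed
  \<comment> \<open>A diagonal in this slot would hide the spoke unless \<open>u + L + 1\<close>
    were within two of an end of the slot, which the residues forbid.\<close>
  have empty: "f x \<noteq> t sH" if "sH \<le> x" "x \<le> sH + 2" for x
  proof
    assume "f x = t sH"
    then have "\<not> (x < u + L + 1 \<and> u + L + 1 < x + L - 2)"
      using r_neq_f[of x "u + L + 1"] sH(1) by auto
    then have "u + L + 1 \<in> {sH, sH + 1, sH + 2} \<or> u + L + 1 \<in> {sH + L - 2, sH + L - 1, sH + L}"
      using that sH(3,4) by auto
    then show False using sH(2) res(1) by (elim disjE insertE emptyE; presburger)
  qed
  obtain x1 where x1: "w \<le> x1" "x1 \<le> w + 3" "f x1 = t (w + L + 1)"
    using slots_exact(1)[OF empty] by blast
  \<comment> \<open>Residues 3 and 1 rule out the wedge case, and \<open>x1\<close> rules out the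
    unpaired colour. The slot differs from \<open>sH\<close>, so it is filled by some
    \<open>f x\<close>, which must not hide the spoke.\<close>
  have spoke: "\<exists>s x. r y = t s \<and> 3 \<le> s mod 5 \<and> s \<le> x \<and> x \<le> s + 2 \<and> f x = t s \<and>
      s \<le> y \<and> y \<le> s + L \<and> (y \<le> x \<or> x + L - 2 \<le> y)"
    if y: "y = u - 1 \<or> y = u + 2" for y
  proof (cases rule: visible_cases[of y])
    case (side s)
    have "s mod m \<noteq> sH mod m"
    proof
      assume "s mod m = sH mod m"
      then have "m dvd s - sH" using mod_eq_dvd_iff[of s m sH] by simp
      moreover have "s \<noteq> u - 1 - L" by (rule notI, use side(2) res(8) in simp)
      ultimately have "s = sH" using side(3,4) y sH(3,4) by (intro int_dvd_diff_eq) auto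
      then have "s = u + 2" using side(3) y sH(3) by auto
      then show False using side(2) res(3) by simp
    qed
    then obtain x where x: "s \<le> x" "x \<le> s + 2" "f x = t s" using slots_exact(2)[OF empty] by blast
    moreover have "\<not> (x < y \<and> y < x + L - 2)" using side(1) x(3) r_neq_f[of x y] by auto
    then have "y \<le> x \<or> x + L - 2 \<le> y" by linarith
    ultimately show ?thesis using side by blast
  next
    case (far s)
    then have s: "s = w + L + 1 - m" using u y by (intro far_unique[of s y]) auto
    then have "t s = t (w + L + 1)" by (simp only: t_period')
    then have "\<not> (x1 < y \<and> y < x1 + L - 2)" using r_neq_f[of x1 y] far(1) x1(3) by auto
    then have "y = w + 2 \<and> y mod 5 = 3 \<or> y = w + 3 \<and> y mod 5 = 3 \<or>
        y = w + L - 2 \<and> y mod 5 = 1 \<or> y = w + L - 1 \<and> y mod 5 = 1"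
      using y u x1(1,2) res(2,3) by auto
    moreover have "(w + L + 1 - m) mod 5 \<le> 2" using far(3) s by simp
    ultimately have False by presburger
    then show ?thesis ..
  next
    case wedge
    then show ?thesis using y res(2,3) by metis
  qed
  \<comment> \<open>By residues, \<open>u - 1\<close> can only be \<open>s\<close> or
    \<open>s + L - 2\<close>; the second choice also fixes which diagonal fills the slot.\<close>
  have ra: "r (u - 1) = a \<or> r (u - 1) = d \<and> f (u + L + 2) = d"
  proof -
    obtain s x where s: "r (u - 1) = t s" "3 \<le> s mod 5" "s \<le> x" "x \<le> s + 2" "f x = t s"
      "s \<le> u - 1" "u - 1 \<le> s + L" "u - 1 \<le> x \<or> x + L - 2 \<le> u - 1" using spoke[of "u - 1"] by blast
    then have "u - 1 \<in> {s, s + 1, s + 2, s + L - 2, s + L - 1, s + L}" by auto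
    then have "u - 1 = s \<or> u - 1 = s + L - 2"
      using s(2) res(2) by (elim insertE emptyE) presburger+
    then show ?thesis
    proof
      assume "u - 1 = s" then show ?thesis using s by (simp add: a_def)
    next
      assume *: "u - 1 = s + L - 2"
      then have "x = s" using s h_ge by auto
      moreover have eq: "s + m = u + L + 2" using * by simp
      have "d = t s" "f (u + L + 2) = f s" using t_period[of s] f_period[of s] td by (simp_all only: eq)
      ultimately show ?thesis using s(1,5) by simp
    qed
  qed
  have rk: "r (u + 2) = k \<or> r (u + 2) = b \<and> f (u + 2) = b"
  proof -
    obtain s x where s: "r (u + 2) = t s" "3 \<le> s mod 5" "s \<le> x" "x \<le> s + 2" "f x = t s"
      "s \<le> u + 2" "u + 2 \<le> s + L" "u + 2 \<le> x \<or> x + L - 2 \<le> u + 2" using spoke[of "u + 2"] by blast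
    then have "u + 2 \<in> {s, s + 1, s + 2, s + L - 2, s + L - 1, s + L}" by auto
    then have "u + 2 = s + 2 \<or> u + 2 = s + L"
      using s(2) res(3) by (elim insertE emptyE) presburger+
    then show ?thesis
    proof
      assume *: "u + 2 = s + 2"
      then have "x = u + 2" using s h_ge by auto
      then show ?thesis using * s by (simp add: b_def)
    next
      assume "u + 2 = s + L"
      then have eq: "s + m = u + L + 3" by simp
      have "k = t s" using t_period[of s] tk by (simp only: eq)
      then show ?thesis using s(1) by simp
    qed
  qed
  have e1: "e u = a \<or> e u = b" and e2: "e (u + 1) = b \<or> e (u + 1) = d"
    and e3: "e (u + L + 2) = b \<or> e (u + L + 2) = d" and e4: "e (u + L + 3) = d \<or> e (u + L + 3) = k"
    using e_slot[of u] e_slot[of "u + 1"] e_slot[of "u + L + 2"] e_slot[of "u + L + 3"] u tb td tk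
    by (auto simp: a_def b_def d_def)
  \<comment> \<open>The hidden arc starts after the far endpoint of \<open>e u\<close>, so
    \<open>u - 1\<close> enters it as \<open>u - 1 + m\<close>.\<close>
  have "r (u - 1 + m) \<noteq> e u"
    by (rule r_neq_e'[OF u5]) (use h_ge in linarith)+
  then have h1: "r (u - 1) \<noteq> e u" by (simp only: r_period not_False_eq_True)
  have h2: "r (u + 2) \<noteq> e (u + 1)"
    by (rule r_neq_e) (use res(4) h_ge in linarith)+
  have "r (u - 1 + m) \<noteq> e (u + L + 2)"
    by (rule r_neq_e) (use res(5) h_ge in linarith)+
  then have h3: "r (u - 1) \<noteq> e (u + L + 2)" by (simp only: r_period not_False_eq_True)
  have "r (u + 2 + m) \<noteq> e (u + L + 3)"
    by (rule r_neq_e'[OF res(6)]) (use h_ge in linarith)+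
  then have h4: "r (u + 2) \<noteq> e (u + L + 3)" by (simp only: r_period not_False_eq_True)
  have x1: "e u \<noteq> f (u + 2)" and x2: "e (u + 1) \<noteq> f (u + 3)"
    and x3: "e (u + L + 2) \<noteq> f (u + L + 1)" and x4: "e (u + L + 3) \<noteq> f (u + L + 2)"
    using e_neq_f(1)[of u] e_neq_f(1)[of "u + 1"] e_neq_f(2)[of "u + L + 1"] e_neq_f(2)[of "u + L + 2"]
    by (simp_all add: add.assoc)
  \<comment> \<open>Each alternative fixes two of the four \<open>e\<close> colours, then both spoke
    colours, and leaves no colour for one remaining \<open>e\<close>.\<close>
  from dichotomy[OF u sH(3,4) empty]
  have "f (u + L + 1) = b \<and> f (u + L + 2) = d \<or> f (u + 2) = b \<and> f (u + 3) = d"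
    by (simp only: tb td b_def[symmetric] d_def[symmetric])
  then show False
  proof
    assume f: "f (u + L + 1) = b \<and> f (u + L + 2) = d"
    then have "e (u + L + 3) = k" "e (u + L + 2) = d" using e3 e4 x3 x4 by auto
    then have "r (u + 2) = b" "f (u + 2) = b" "r (u - 1) = a" using ra rk h3 h4 by auto
    then show False using e1 h1 x1 by auto
  next
    assume f: "f (u + 2) = b \<and> f (u + 3) = d"
    then have "e u = a" "e (u + 1) = b" using e1 e2 x1 x2 by auto
    then have "f (u + L + 2) = d" "r (u + 2) = k" using ra rk h1 h2 by auto
    then show False using e4 h4 x4 by auto
  qed
qed

end

lemma (in wheel_colouring) no_colouring: False
proof -
  obtain w where w: "\<And>p. w < p \<Longrightarrow> p \<le> w + L \<Longrightarrow> t p = t (p + L + 1)"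
    "\<And>y. w + L + 1 < y \<Longrightarrow> y < w + L + 1 + m \<Longrightarrow> t y \<noteq> t (w + L + 1)"
    "t ` {0..<m} = C"
    by (rule t_pairing) blast
  interpret paired_wheel_colouring h C c r w by unfold_locales (use w in auto)
  show False by (rule contradiction)
qed

section \<open>Points in convex position around a centre\<close>

definition cross2 :: "complex \<Rightarrow> complex \<Rightarrow> real" where
  "cross2 z w = Re z * Im w - Im z * Re w"

definition orient :: "complex \<Rightarrow> complex \<Rightarrow> complex \<Rightarrow> real" where
  "orient a b c = cross2 (b - a) (c - a)"

lemma orient_rotate: "orient b c a = orient a b c"
  by (simp add: orient_def cross2_def algebra_simps)

lemma orient_decompose: "orient a b c = cross2 (a - z) (b - z) + cross2 (b - z) (c - z) + cross2 (c - z) (a - z)"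
  by (simp add: orient_def cross2_def algebra_simps)

lemma cross2_swap: "cross2 w z = - cross2 z w"
  by (simp add: cross2_def)

lemma cross2_cnj: "cross2 z w = Im (cnj z * w)"
  by (simp add: cross2_def)

text \<open>The areas of the four triangles are the coefficients of the affine dependence
  \<open>A a + C c = B b + D d\<close> with \<open>A + C = B + D\<close>; normalising either side
  gives the common point.\<close>

lemma open_segments_meet:
  assumes "0 < orient b c d" "0 < orient a c d" "0 < orient a b d" "0 < orient a b c"
  shows "open_segment a c \<inter> open_segment b d \<noteq> {}"
proof -
  define A B C D where "A = orient b c d" and "B = orient a c d" and "C = orient a b d"
    and "D = orient a b c"
  have pos: "0 < A" "0 < B" "0 < C" "0 < D" using assms by (simp_all add: A_def B_def C_def D_def)
  have sum: "A + C = B + D"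
    by (simp add: A_def B_def C_def D_def orient_def cross2_def algebra_simps)
  have bal: "A *\<^sub>R a + C *\<^sub>R c = B *\<^sub>R b + D *\<^sub>R d"
    by (simp add: complex_eq_iff A_def B_def C_def D_def orient_def cross2_def algebra_simps)
  define z where "z = (1 / (A + C)) *\<^sub>R (A *\<^sub>R a + C *\<^sub>R c)"
  have "a \<noteq> c" "b \<noteq> d" using assms by (auto simp: orient_def cross2_def)
  have in_seg: "(1 / (s + s')) *\<^sub>R (s *\<^sub>R x + s' *\<^sub>R y) \<in> open_segment x y"
    if "0 < s" "0 < s'" "x \<noteq> y" for s s' :: real and x y :: complex
  proof -
    have 1: "1 - s' / (s + s') = s / (s + s')" using that by (simp add: field_simps)
    then show ?thesis
      unfolding in_segment using that
      by (intro conjI exI[of _ "s' / (s + s')"]) (simp_all add: 1 scaleR_add_right)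
  qed
  have "z \<in> open_segment a c" using in_seg[OF pos(1,3) \<open>a \<noteq> c\<close>] by (simp add: z_def)
  moreover have "z \<in> open_segment b d"
    using in_seg[OF pos(2,4) \<open>b \<noteq> d\<close>] by (simp add: z_def bal sum)
  ultimately show ?thesis by blast
qed

lemma rel_interior_edge: "a \<noteq> b \<Longrightarrow> rel_interior (convex hull {a, b}) = open_segment a b"
  for a b :: complex
  using rel_interior_closed_segment[of a b] by (simp add: segment_convex_hull)

section \<open>The indexed wheel and its crossings\<close>

text \<open>\<open>turn\<close> encodes counterclockwise order about the centre: advancing by at
  most \<open>h\<close> groups turns through less than half a circle.\<close>

locale wheel_points =
  fixes h :: int and P :: "int \<Rightarrow> complex" and v0 :: complex and Q :: "complex set"
  assumes period: "\<And>i. P (i + (10 * h + 5)) = P i"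
    and turn: "\<And>i j. i < j \<Longrightarrow> j div 5 \<le> i div 5 + h \<Longrightarrow> 0 < cross2 (P i - v0) (P j - v0)"
    and extreme: "\<And>i. P i extreme_point_of convex hull Q"
    and centre: "v0 \<in> convex hull Q"
begin

lemma period_div: "(i + (10 * h + 5)) div 5 = i div 5 + 2 * h + 1"
  by presburger

text \<open>Otherwise \<open>P j\<close> would lie in the triangle spanned by the centre, \<open>P i\<close> and \<open>P l\<close>, which
  contradicts extremality.\<close>

lemma orient_near:
  assumes "i < j" "j < l" "l div 5 \<le> i div 5 + h"
  shows "0 < orient (P i) (P j) (P l)"
proof (rule ccontr)
  assume neg: "\<not> 0 < orient (P i) (P j) (P l)"
  define u v w where "u = P i - v0" and "v = P j - v0" and "w = P l - v0"
  have "i div 5 \<le> j div 5" "j div 5 \<le> l div 5" using assms(1,2) by (simp_all add: zdiv_mono1)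
  then have pos: "0 < cross2 u v" "0 < cross2 v w" "0 < cross2 u w"
    unfolding u_def v_def w_def using assms by (auto intro!: turn)
  define \<alpha> \<beta> where "\<alpha> = cross2 v w / cross2 u w" and "\<beta> = cross2 u v / cross2 u w"
  have ab: "0 < \<alpha>" "0 < \<beta>" using pos by (simp_all add: \<alpha>_def \<beta>_def)
  have "cross2 v w + cross2 u v \<le> cross2 u w"
    using neg orient_decompose[of "P i" "P j" "P l" v0] cross2_swap[of u w]
    by (simp add: u_def v_def w_def)
  then have le: "\<alpha> + \<beta> \<le> 1" using pos by (simp add: \<alpha>_def \<beta>_def field_simps)
  \<comment> \<open>Cramer's rule for \<open>v\<close> in the basis \<open>u\<close>,
    \<open>w\<close>.\<close>
  have "cross2 u w *\<^sub>R v = cross2 v w *\<^sub>R u + cross2 u v *\<^sub>R w"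
    by (simp add: complex_eq_iff cross2_def algebra_simps)
  then have "v = (1 / cross2 u w) *\<^sub>R (cross2 v w *\<^sub>R u + cross2 u v *\<^sub>R w)"
    using pos by (metis divide_self_if less_irrefl scaleR_one scaleR_scaleR times_divide_eq_left mult_1)
  then have "v = \<alpha> *\<^sub>R u + \<beta> *\<^sub>R w" by (simp add: \<alpha>_def \<beta>_def scaleR_add_right)
  then have "P j = (1 - \<alpha> - \<beta>) *\<^sub>R v0 + \<alpha> *\<^sub>R P i + \<beta> *\<^sub>R P l"
    by (simp add: u_def v_def w_def algebra_simps)
  then have mem: "P j \<in> convex hull {v0, P i, P l}"
    unfolding convex_hull_3 using ab le by (intro CollectI exI[of _ "1 - \<alpha> - \<beta>"] exI[of _ \<alpha>] exI[of _ \<beta>]) auto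
  have "convex hull {v0, P i, P l} \<subseteq> convex hull Q"
    using centre extreme by (intro hull_minimal) (auto simp: extreme_point_of_def)
  then have "P j extreme_point_of (convex hull {v0, P i, P l})"
    using mem extreme[of j] by (auto simp: extreme_point_of_def)
  then have "P j \<in> {v0, P i, P l}" by (rule extreme_point_of_convex_hull)
  then show False using pos by (auto simp: u_def v_def w_def cross2_def)
qed

text \<open>Either all three arcs span at most \<open>h\<close> group steps and the three cross
  products at the centre are positive, or one arc is longer and the other two together span at most
  \<open>h\<close>.\<close>

lemma orient_pos:
  assumes "i < j" "j < l" "l < i + (10 * h + 5)"
  shows "0 < orient (P i) (P j) (P l)"
proof -
  let ?m = "10 * h + 5"
  consider "j div 5 \<le> i div 5 + h" "l div 5 \<le> j div 5 + h" "(i + ?m) div 5 \<le> l div 5 + h"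
    | "l div 5 \<le> i div 5 + h" | "(i + ?m) div 5 \<le> j div 5 + h" | "(j + ?m) div 5 \<le> l div 5 + h"
    unfolding period_div by linarith
  then show ?thesis
  proof cases
    case 1
    then show ?thesis
      using turn[of i j] turn[of j l] turn[of l "i + ?m"] assms period[of i]
        orient_decompose[of "P i" "P j" "P l" v0] by simp
  next
    case 2
    then show ?thesis using assms by (intro orient_near)
  next
    case 3
    then have "0 < orient (P j) (P l) (P (i + ?m))" using assms by (intro orient_near) auto
    then show ?thesis by (simp only: period orient_rotate)
  next
    case 4
    then have "0 < orient (P l) (P (i + ?m)) (P (j + ?m))" using assms by (intro orient_near) auto
    then show ?thesis by (simp only: period orient_rotate)
  qed
qed

lemma P_neq: "i < j \<Longrightarrow> j < i + (10 * h + 5) \<Longrightarrow> P i \<noteq> P j"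
  using turn[of i j] turn[of j "i + (10 * h + 5)"] period[of i] period_div[of i]
  by (cases "j div 5 \<le> i div 5 + h") (auto simp: cross2_def)

lemma P_neq_centre: "1 \<le> h \<Longrightarrow> P i \<noteq> v0"
proof -
  assume "1 \<le> h"
  then have "(i + 1) div 5 \<le> i div 5 + h" by presburger
  then have "0 < cross2 (P i - v0) (P (i + 1) - v0)" by (intro turn) auto
  then show ?thesis by (auto simp: cross2_def)
qed

lemma chords_cross:
  assumes "i < k" "k < j" "j < l" "l < i + (10 * h + 5)"
  shows "open_segment (P i) (P j) \<inter> open_segment (P k) (P l) \<noteq> {}"
  using assms by (intro open_segments_meet orient_pos) auto

text \<open>The spoke and the chord are the diagonals of the convex quadrilateral \<open>v0\<close>,
  \<open>P i\<close>, \<open>P y\<close>, \<open>P j\<close>.\<close>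

lemma spoke_crosses:
  assumes "i < y" "y < j" "j div 5 \<le> i div 5 + h"
  shows "open_segment v0 (P y) \<inter> open_segment (P i) (P j) \<noteq> {}"
proof (rule open_segments_meet)
  have d: "i div 5 \<le> y div 5" "y div 5 \<le> j div 5" using assms by (simp_all add: zdiv_mono1)
  show "0 < orient (P i) (P y) (P j)" using assms by (rule orient_near)
  show "0 < orient v0 (P y) (P j)" "0 < orient v0 (P i) (P j)" "0 < orient v0 (P i) (P y)"
    unfolding orient_def using assms d by (auto intro!: turn)
qed

end

section \<open>Indexing the points of a bumpy wheel by angle\<close>

lemma strictly_sorted_enumeration:
  fixes \<kappa> :: "'a \<Rightarrow> real"
  assumes "finite S" "inj_on \<kappa> S"
  obtains q where "\<And>i. i < card S \<Longrightarrow> q i \<in> S"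
    and "\<And>i j. i < j \<Longrightarrow> j < card S \<Longrightarrow> \<kappa> (q i) < \<kappa> (q j)"
proof -
  define xs where "xs = sorted_list_of_set (\<kappa> ` S)"
  define q where "q i = inv_into S \<kappa> (xs ! i)" for i
  have len: "length xs = card S" using assms by (simp add: xs_def card_image)
  have set_xs: "set xs = \<kappa> ` S" using assms(1) by (simp add: xs_def)
  have nth: "xs ! i \<in> \<kappa> ` S" if "i < card S" for i
    using nth_mem[of i xs] that len set_xs by simp
  have "sorted_wrt (<) xs" by (simp add: xs_def)
  then have "xs ! i < xs ! j" if "i < j" "j < card S" for i j
    using that len by (simp add: sorted_wrt_iff_nth_less)
  moreover have "\<kappa> (q i) = xs ! i" if "i < card S" for i
    using f_inv_into_f[OF nth[OF that]] by (simp add: q_def)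
  moreover have "q i \<in> S" if "i < card S" for i
    using inv_into_into[OF nth[OF that]] by (simp add: q_def)
  ultimately show thesis by (intro that[of q]) auto
qed

lemma polygon_vertex_mod:
  assumes "0 < k"
  shows "cis (t + 2 * pi * real (nat (g mod int k)) / real k) = cis (t + 2 * pi * real_of_int g / real k)"
proof -
  have "real_of_int (g mod int k) = real_of_int (g - int k * (g div int k))"
    by (simp only: minus_mult_div_eq_mod)
  then have eq: "real_of_int g = real (nat (g mod int k)) + real k * real_of_int (g div int k)"
    using assms by simp
  have "t + 2 * pi * real_of_int g / real k =
      (t + 2 * pi * real (nat (g mod int k)) / real k) + 2 * pi * real_of_int (g div int k)"
    by (simp only: eq) (use assms in \<open>simp add: add_divide_distrib distrib_left\<close>)
  then show ?thesis by (simp add: cis_mult[symmetric])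
qed

text \<open>The angle lies between \<open>pi / n\<close> and \<open>pi - pi / n\<close>, so
  monotonicity up to \<open>pi / 2\<close> and reflection suffice.\<close>

lemma sin_ge_sin_pi_div:
  assumes "1 \<le> d" "2 * d + 1 \<le> n"
  shows "sin (pi / n) \<le> sin (2 * pi * d / n)"
proof -
  have n: "0 < n" using assms by linarith
  have "0 < pi / n" using n by simp
  then have low: "- (pi / 2) \<le> pi / n" using pi_gt_zero by linarith
  show ?thesis
  proof (cases "2 * pi * d / n \<le> pi / 2")
    case True
    have "pi * 1 \<le> pi * (2 * d)" using assms(1) by (intro mult_left_mono) auto
    then have "pi / n \<le> 2 * pi * d / n" using n by (intro divide_right_mono) auto
    then show ?thesis using True low by (intro sin_monotone_2pi_le)
  next
    case False
    have "pi * (2 * d + 1) \<le> pi * n" using assms(2) by (intro mult_left_mono) auto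
    then have "pi * (2 * d + 1) / n \<le> pi" using n by (simp only: pos_divide_le_eq)
    moreover have "pi * (2 * d + 1) / n = 2 * pi * d / n + pi / n"
      by (simp add: add_divide_distrib distrib_left)
    ultimately have "pi / n \<le> pi - 2 * pi * d / n" by linarith
    then have "sin (pi / n) \<le> sin (pi - 2 * pi * d / n)"
      using False low by (intro sin_monotone_2pi_le) auto
    then show ?thesis by simp
  qed
qed

text \<open>Bilinearity leaves three error terms, each at most \<open>r * \<epsilon>\<close> in
  absolute value.\<close>

lemma cross2_near:
  fixes r :: real
  assumes "0 < r" "\<epsilon> \<le> r"
    and "norm (z - of_real r * cis a) < \<epsilon>" "norm (w - of_real r * cis b) < \<epsilon>"
  shows "r\<^sup>2 * sin (b - a) - 3 * r * \<epsilon> < cross2 z w"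
proof -
  define z' w' where "z' = z - of_real r * cis a" and "w' = w - of_real r * cis b"
  have \<epsilon>: "0 < \<epsilon>" using assms(3) norm_ge_zero le_less_trans by blast
  have cross2_le: "\<bar>cross2 x y\<bar> \<le> norm x * norm y" for x y
    using abs_Im_le_cmod[of "cnj x * y"] by (simp add: cross2_cnj norm_mult)
  have split: "cross2 z w = cross2 (of_real r * cis a) (of_real r * cis b) + cross2 (of_real r * cis a) w'
      + cross2 z' (of_real r * cis b) + cross2 z' w'"
    by (simp add: z'_def w'_def cross2_def algebra_simps)
  have main: "cross2 (of_real r * cis a) (of_real r * cis b) = r\<^sup>2 * sin (b - a)"
    by (simp add: cross2_def sin_diff power2_eq_square algebra_simps)
  have less: "r * norm z' < r * \<epsilon>" "r * norm w' < r * \<epsilon>"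
    using assms(1,3,4) by (simp_all add: z'_def w'_def)
  have "\<bar>cross2 (of_real r * cis a) w'\<bar> \<le> r * norm w'" "\<bar>cross2 z' (of_real r * cis b)\<bar> \<le> r * norm z'"
    using cross2_le[of "of_real r * cis a" w'] cross2_le[of z' "of_real r * cis b"] assms(1)
    by (simp_all add: norm_mult mult.commute)
  moreover have "\<bar>cross2 z' w'\<bar> \<le> r * \<epsilon>"
  proof -
    have "norm z' * norm w' \<le> r * \<epsilon>"
      using assms by (intro mult_mono) (auto simp: z'_def w'_def)
    then show ?thesis using cross2_le[of z' w'] by linarith
  qed
  ultimately show ?thesis unfolding split main using less by linarith
qed

text \<open>The tangent of the angle of \<open>x\<close> about \<open>v0\<close>, measured from
  direction \<open>a\<close>; it orders the points of the open half-plane around \<open>a\<close> by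
  angle.\<close>

definition slope :: "complex \<Rightarrow> real \<Rightarrow> complex \<Rightarrow> real" where
  "slope v0 a x = Im ((x - v0) * cis (- a)) / Re ((x - v0) * cis (- a))"

lemma cross2_slope:
  assumes "0 < Re ((x - v0) * cis (- a))" "0 < Re ((y - v0) * cis (- a))"
  shows "cross2 (x - v0) (y - v0) = Re ((x - v0) * cis (- a)) * Re ((y - v0) * cis (- a)) *
    (slope v0 a y - slope v0 a x)"
proof -
  have polar: "cross2 z w = Re z * Re w * (Im w / Re w - Im z / Re z)" if "0 < Re z" "0 < Re w" for z w
    using that by (simp add: cross2_def field_simps)
  have "cross2 (z * cis b) (w * cis b) = ((cos b)\<^sup>2 + (sin b)\<^sup>2) * cross2 z w" for z w b
    by (simp only: cross2_def times_complex.sel cis.sel) algebra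
  then have "cross2 (x - v0) (y - v0) = cross2 ((x - v0) * cis (- a)) ((y - v0) * cis (- a))"
    by (simp del: cis.sel)
  also have "\<dots> = Re ((x - v0) * cis (- a)) * Re ((y - v0) * cis (- a)) *
    (slope v0 a y - slope v0 a x)"
    unfolding slope_def by (rule polar) (use assms in auto)
  finally show ?thesis .
qed

lemma Re_rotated_pos:
  assumes "norm (z - of_real r * cis a) < \<epsilon>" "\<epsilon> \<le> r"
  shows "0 < Re (z * cis (- a))"
proof -
  have "z * cis (- a) - of_real r = (z - of_real r * cis a) * cis (- a)"
    by (simp add: algebra_simps cis_mult)
  then have "norm (z * cis (- a) - of_real r) < \<epsilon>" using assms(1) by (simp add: norm_mult)
  then have "\<bar>Re (z * cis (- a)) - r\<bar> < \<epsilon>"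
    using abs_Re_le_cmod[of "z * cis (- a) - of_real r"] by simp
  then show ?thesis using assms(2) by linarith
qed

lemma cross2_eq_0_collinear:
  assumes "cross2 (x - v0) (y - v0) = 0"
  shows "collinear {x, v0, y}"
proof (cases "x = v0")
  case False
  define u w where "u = x - v0" and "w = y - v0"
  have u0: "(Re u)\<^sup>2 + (Im u)\<^sup>2 \<noteq> 0"
    using False by (simp add: u_def complex_eq_iff sum_power2_eq_zero_iff)
  have cr0: "Re u * Im w = Im u * Re w" using assms by (simp add: cross2_def u_def w_def)
  have "((Re u)\<^sup>2 + (Im u)\<^sup>2) *\<^sub>R w = (Re u * Re w + Im u * Im w) *\<^sub>R u"
    using cr0 by (simp add: complex_eq_iff power2_eq_square algebra_simps)
  then have "w = (1 / ((Re u)\<^sup>2 + (Im u)\<^sup>2)) *\<^sub>R ((Re u * Re w + Im u * Im w) *\<^sub>R u)"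
    using u0 by (metis divide_self_if scaleR_one scaleR_scaleR times_divide_eq_left mult_1)
  then have "w = ((Re u * Re w + Im u * Im w) / ((Re u)\<^sup>2 + (Im u)\<^sup>2)) *\<^sub>R u" by simp
  then have "collinear {0, u, w}" by (metis collinear_lemma)
  then have "collinear {0, x - v0, y - v0}" by (simp add: u_def w_def)
  then show ?thesis by (simp add: collinear_3)
qed simp

text \<open>Each group is sorted by slope about its own direction; \<open>i div 5\<close> modulo
  \<open>k\<close> then selects the group and \<open>i mod 5\<close> the rank in it.\<close>

lemma bumpy_wheel_points:
  assumes "bumpy_wheel k 5 v0 r t \<epsilon> W" "\<epsilon> \<le> r * sin (pi / real k) / 3"
  obtains P Q where "wheel_points (int k div 2) P v0 Q" "\<And>i. P i \<in> Q" "v0 \<in> Q"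
    "W = complete_geometric_graph Q"
proof -
  have k: "odd k" "3 \<le> k" and r: "0 < r" and \<epsilon>: "0 < \<epsilon>"
    using assms(1) by (simp_all add: bumpy_wheel_def)
  obtain S Q where SQ: "Q = insert v0 (\<Union>j<k. S j) \<and>
      (\<forall>j<k. finite (S j) \<and> card (S j) = 5) \<and>
      (\<forall>j<k. \<forall>x\<in>S j. dist x (regular_polygon_vertex k v0 r t j) < \<epsilon>) \<and>
      general_position Q \<and>
      (\<forall>j<k. \<forall>x\<in>S j. x extreme_point_of (convex hull Q)) \<and>
      W = complete_geometric_graph Q"
    using assms(1) unfolding bumpy_wheel_def
    by (elim conjE exE) (rule that, intro conjI; assumption)
  then have Q: "Q = insert v0 (\<Union>j<k. S j)"
    and S: "\<And>j. j < k \<Longrightarrow> finite (S j)" "\<And>j. j < k \<Longrightarrow> card (S j) = 5"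
    and near: "\<And>j x. j < k \<Longrightarrow> x \<in> S j \<Longrightarrow> dist x (regular_polygon_vertex k v0 r t j) < \<epsilon>"
    and gp: "general_position Q"
    and ext: "\<And>j x. j < k \<Longrightarrow> x \<in> S j \<Longrightarrow> x extreme_point_of (convex hull Q)"
    and W: "W = complete_geometric_graph Q"
    by blast+
  have "r * sin (pi / real k) \<le> r * 1" by (rule mult_left_mono) (use r in auto)
  then have \<epsilon>r: "\<epsilon> \<le> r" using assms(2) r by linarith
  define \<theta> where "\<theta> g = t + 2 * pi * real_of_int g / real k" for g :: int
  define \<kappa> where "\<kappa> j = slope v0 (\<theta> (int j))" for j
  have near': "norm ((x - v0) - of_real r * cis (\<theta> (int j))) < \<epsilon>" if "j < k" "x \<in> S j" for j x
    using near[OF that] by (simp add: dist_norm regular_polygon_vertex_def \<theta>_def algebra_simps)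
  have Re_pos: "0 < Re ((x - v0) * cis (- \<theta> (int j)))" if "j < k" "x \<in> S j" for j x
    using Re_rotated_pos[OF near'[OF that] \<epsilon>r] .
  \<comment> \<open>Equal slopes would put two points of a group on a line through the centre,
    against general position.\<close>
  have inj: "inj_on (\<kappa> j) (S j)" if j: "j < k" for j
  proof (rule inj_onI, rule ccontr)
    fix x y assume xy: "x \<in> S j" "y \<in> S j" "\<kappa> j x = \<kappa> j y" "x \<noteq> y"
    have "x \<noteq> v0" "y \<noteq> v0" using Re_pos[OF j xy(1)] Re_pos[OF j xy(2)] by auto
    moreover have "collinear {x, v0, y}"
      using cross2_slope[OF Re_pos[OF j xy(1)] Re_pos[OF j xy(2)]] xy(3)
      by (intro cross2_eq_0_collinear) (simp add: \<kappa>_def)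
    moreover have "x \<in> Q" "y \<in> Q" "v0 \<in> Q" using Q j xy(1,2) by auto
    ultimately show False using gp xy(4) unfolding general_position_def by metis
  qed
  have "\<forall>j. \<exists>q. j < k \<longrightarrow> (\<forall>i<5::nat. q i \<in> S j) \<and> (\<forall>i i'. i < i' \<longrightarrow> i' < 5 \<longrightarrow> \<kappa> j (q i) < \<kappa> j (q i'))"
  proof
    fix j
    show "\<exists>q. j < k \<longrightarrow> (\<forall>i<5::nat. q i \<in> S j) \<and> (\<forall>i i'. i < i' \<longrightarrow> i' < 5 \<longrightarrow> \<kappa> j (q i) < \<kappa> j (q i'))"
    proof (cases "j < k")
      case True
      show ?thesis
        by (rule strictly_sorted_enumeration[OF S(1)[OF True] inj[OF True]])
          (use S(2)[OF True] in auto)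
    qed simp
  qed
  then obtain q where q: "\<And>j i. j < k \<Longrightarrow> i < (5::nat) \<Longrightarrow> q j i \<in> S j"
    "\<And>j i i'. j < k \<Longrightarrow> i < i' \<Longrightarrow> i' < 5 \<Longrightarrow> \<kappa> j (q j i) < \<kappa> j (q j i')"
    by metis
  define grp where "grp i = nat (i div 5 mod int k)" for i :: int
  define P where "P i = q (grp i) (nat (i mod 5))" for i
  have grp: "grp i < k" for i using k by (simp add: grp_def nat_less_iff)
  have P_in: "P i \<in> S (grp i)" for i using q(1)[OF grp] by (simp add: P_def nat_less_iff)
  have P_near: "norm ((P i - v0) - of_real r * cis (\<theta> (i div 5))) < \<epsilon>" for i
    using near'[OF grp P_in, of i] polygon_vertex_mod[of k t "i div 5"] k
    by (simp add: \<theta>_def grp_def)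
  have "wheel_points (int k div 2) P v0 Q"
  proof
    let ?h = "int k div 2"
    have h: "2 * ?h + 1 = int k" using k by presburger
    fix i j
    have "i + (10 * ?h + 5) = i + int k * 5" using h by linarith
    then have "(i + (10 * ?h + 5)) div 5 = i div 5 + int k" "(i + (10 * ?h + 5)) mod 5 = i mod 5"
      by simp_all
    then show "P (i + (10 * ?h + 5)) = P i" by (simp add: P_def grp_def)
    show "P i extreme_point_of convex hull Q" using ext[OF grp P_in] .
    show "v0 \<in> convex hull Q" using Q by (simp add: hull_inc)
    assume ij: "i < j" "j div 5 \<le> i div 5 + ?h"
    show "0 < cross2 (P i - v0) (P j - v0)"
    proof (cases "i div 5 = j div 5")
      case True
      then have "i mod 5 < j mod 5" using ij(1) by (metis div_mult_mod_eq add_less_cancel_left)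
      then have "nat (i mod 5) < nat (j mod 5)" by simp
      then have less: "\<kappa> (grp i) (P i) < \<kappa> (grp i) (P j)"
        using q(2)[OF grp[of i], of "nat (i mod 5)" "nat (j mod 5)"] True
        by (simp add: P_def grp_def nat_less_iff)
      have "P j \<in> S (grp i)" using P_in[of j] True by (simp add: grp_def)
      then show ?thesis
        using cross2_slope[OF Re_pos[OF grp P_in, of i] Re_pos[OF grp, of "P j" i]]
          Re_pos[OF grp P_in, of i] Re_pos[OF grp, of "P j" i] less
        by (simp add: \<kappa>_def)
    next
      \<comment> \<open>For different groups the polygon vertices contribute at least
        \<open>r\<^sup>2 * sin (pi / real k)\<close>, which absorbs the perturbation
        \<open>3 * r * \<epsilon>\<close>.\<close>
      case False
      define d where "d = j div 5 - i div 5"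
      have d: "1 \<le> d" "2 * d + 1 \<le> int k"
        using ij False zdiv_mono1[of i j 5] h by (auto simp: d_def)
      have "\<theta> (j div 5) - \<theta> (i div 5) = 2 * pi * real_of_int d / real k"
        by (simp add: \<theta>_def d_def diff_divide_distrib right_diff_distrib)
      moreover have "2 * real_of_int d + 1 \<le> real k" using d(2) by linarith
      ultimately have "sin (pi / real k) \<le> sin (\<theta> (j div 5) - \<theta> (i div 5))"
        using d(1) sin_ge_sin_pi_div[of "real_of_int d" "real k"] by simp
      then have "r\<^sup>2 * sin (pi / real k) \<le> r\<^sup>2 * sin (\<theta> (j div 5) - \<theta> (i div 5))"
        by (intro mult_left_mono) auto
      moreover have "3 * r * \<epsilon> \<le> r\<^sup>2 * sin (pi / real k)"
        using mult_left_mono[OF assms(2), of "3 * r"] r by (simp add: power2_eq_square)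
      moreover have "r\<^sup>2 * sin (\<theta> (j div 5) - \<theta> (i div 5)) - 3 * r * \<epsilon> < cross2 (P i - v0) (P j - v0)"
        by (rule cross2_near[OF r \<epsilon>r P_near P_near])
      ultimately show ?thesis by linarith
    qed
  qed
  moreover have "P i \<in> Q" for i using P_in[of i] grp[of i] Q by auto
  ultimately show thesis using that[of P Q] Q W by auto
qed

section \<open>Plane partitions\<close>

lemma (in wheel_points) no_plane_partition:
  assumes h: "2 \<le> h" and P_in: "\<And>i. P i \<in> Q" and centre_in: "v0 \<in> Q"
    and part: "graph_partition (complete_geometric_graph Q) \<H>"
    and plane: "\<And>H. H \<in> \<H> \<Longrightarrow> plane_graph H"
  shows "int (card \<H>) \<noteq> 5 * h + 3"
proof
  assume card: "int (card \<H>) = 5 * h + 3"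
  \<comment> \<open>The parts themselves serve as colours, so equally coloured edges lie in a common
    plane subgraph.\<close>
  define col where "col e = (SOME H. H \<in> \<H> \<and> e \<in> edges H)" for e
  have col: "col {x, y} \<in> \<H> \<and> {x, y} \<in> edges (col {x, y})" if "x \<in> Q" "y \<in> Q" "x \<noteq> y" for x y
  proof -
    have "{x, y} \<in> edges (complete_geometric_graph Q)"
      using that by (simp add: complete_geometric_graph_def)
    then have "\<exists>H. H \<in> \<H> \<and> {x, y} \<in> edges H"
      using part unfolding graph_partition_def by blast
    then show ?thesis unfolding col_def by (rule someI_ex)
  qed
  have meet: "col {x, y} \<noteq> col {x', y'}"
    if "x \<in> Q" "y \<in> Q" "x' \<in> Q" "y' \<in> Q" "x \<noteq> y" "x' \<noteq> y'" "{x, y} \<noteq> {x', y'}"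
      "open_segment x y \<inter> open_segment x' y' \<noteq> {}" for x y x' y'
  proof
    assume eq: "col {x, y} = col {x', y'}"
    define H where "H = col {x, y}"
    have H: "H \<in> \<H>" "{x, y} \<in> edges H" "{x', y'} \<in> edges H"
      using col[OF that(1,2,5)] col[OF that(3,4,6)] by (simp_all add: H_def eq)
    have "rel_interior (convex hull {x, y}) \<inter> rel_interior (convex hull {x', y'}) = {}"
      using plane[OF H(1)] H(2,3) that(7) unfolding plane_graph_def by metis
    then show False using that(8) by (simp only: rel_interior_edge[OF that(5)] rel_interior_edge[OF that(6)])
  qed
  have neq: "P i \<noteq> P j" if "i < j" "j < i + (10 * h + 5)" for i j
    using P_neq that .
  have neq0: "P i \<noteq> v0" for i using P_neq_centre h by simp
  interpret wheel_colouring h \<H> "\<lambda>i j. col {P i, P j}" "\<lambda>y. col {v0, P y}"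
  proof
    show "2 \<le> h" "int (card \<H>) = 5 * h + 3" using h card by auto
    show "finite \<H>" using card h by (intro card_ge_0_finite) linarith
  next
    fix i j :: int assume "i < j" "j < i + (10 * h + 5)"
    then show "col {P i, P j} \<in> \<H>" using col[OF P_in P_in neq] by blast
  next
    fix y show "col {v0, P y} \<in> \<H>" using col[OF centre_in P_in, of y] neq0[of y] by metis
  next
    fix i j show "col {P j, P (i + (10 * h + 5))} = col {P i, P j}"
      by (simp add: period insert_commute)
  next
    fix y show "col {v0, P (y + (10 * h + 5))} = col {v0, P y}" by (simp add: period)
  next
    fix i k j l :: int assume a: "i < k" "k < j" "j < l" "l < i + (10 * h + 5)"
    then have "P i \<noteq> P k" "P i \<noteq> P j" "P i \<noteq> P l" "P k \<noteq> P l" using neq by auto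
    then show "col {P i, P j} \<noteq> col {P k, P l}"
      using chords_cross[OF a] P_in by (intro meet) (auto simp: doubleton_eq_iff)
  next
    fix i y j assume a: "i < y" "y < j" "j div 5 \<le> i div 5 + h"
    have "0 < cross2 (P i - v0) (P j - v0)" using a by (intro turn) auto
    then have "P i \<noteq> P j" by (auto simp: cross2_def)
    then show "col {v0, P y} \<noteq> col {P i, P j}"
      using spoke_crosses[OF a] P_in centre_in neq0 neq0[symmetric]
      by (intro meet) (auto simp: doubleton_eq_iff)
  qed
  show False by (rule no_colouring)
qed

theorem theorem24:
  fixes k :: nat and v0 :: complex and r t :: real
  assumes "odd k" and "k \<ge> 5" and "r > 0"
  shows "\<exists>\<epsilon>0>0. \<forall>\<epsilon> W. 0 < \<epsilon> \<and> \<epsilon> < \<epsilon>0 \<and> bumpy_wheel k 5 v0 r t \<epsilon> W \<longrightarrow>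
           \<not> (\<exists>\<H>. graph_partition W \<H> \<and> (\<forall>H\<in>\<H>. plane_graph H) \<and> card \<H> = (5 * k + 1) div 2)"
\<comment> \<open>Below this threshold the error \<open>3 * r * \<epsilon>\<close> is less than the
  smallest cross product of vertices at most \<open>(k - 1) / 2\<close> steps apart.\<close>
proof (intro exI[of _ "r * sin (pi / real k) / 3"] conjI allI impI notI)
  have "0 < sin (pi / real k)" using assms(2) by (intro sin_gt_zero) (auto simp: field_simps)
  then show "0 < r * sin (pi / real k) / 3" using assms(3) by simp
next
  fix \<epsilon> W
  assume W: "0 < \<epsilon> \<and> \<epsilon> < r * sin (pi / real k) / 3 \<and> bumpy_wheel k 5 v0 r t \<epsilon> W"
    and "\<exists>\<H>. graph_partition W \<H> \<and> (\<forall>H\<in>\<H>. plane_graph H) \<and> card \<H> = (5 * k + 1) div 2"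
  then obtain \<H> where \<H>: "graph_partition W \<H>" "\<And>H. H \<in> \<H> \<Longrightarrow> plane_graph H"
    "card \<H> = (5 * k + 1) div 2" by blast
  have "bumpy_wheel k 5 v0 r t \<epsilon> W" "\<epsilon> \<le> r * sin (pi / real k) / 3" using W by simp_all
  then obtain P Q where PQ: "wheel_points (int k div 2) P v0 Q" "\<And>i. P i \<in> Q" "v0 \<in> Q"
    "W = complete_geometric_graph Q" by (rule bumpy_wheel_points) (rule that)
  obtain n where n: "k = 2 * n + 1" using assms(1) by (rule oddE)
  then have "int k div 2 = int n" "card \<H> = 5 * n + 3" using \<H>(3) by simp_all
  then have "2 \<le> int k div 2" "int (card \<H>) = 5 * (int k div 2) + 3" using assms(2) n by simp_all
  moreover have "graph_partition (complete_geometric_graph Q) \<H>" using \<H>(1) PQ(4) by simp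
  ultimately show False
    using wheel_points.no_plane_partition[OF PQ(1) _ PQ(2,3) _ \<H>(2)] by blast
qed

end
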